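(* For every $\varepsilon>0$ there is $k_0$ such that for every $k\ge k_0$ there exist $d$ and a finite point set $\mathcal{X}\subseteq\mathbb{R}^d$ such that every explainable clustering of $\mathcal{X}$ with $k$ clusters has $k$-medians cost at least $(1-\varepsilon)\ln k$ times the optimal (unconstrained) $k$-medians cost of $\mathcal{X}$.
   Context: A threshold tree is a rooted binary tree where each internal node $u$ carries a cut $(i_u,\theta_u)$ with $i_u\in[d]$, $\theta_u\in\mathbb{R}$; the root region is $\mathbb{R}^d$ and the children of $u$ have regions $B_u\cap\{x:x_{i_u}\le\theta_u\}$ and $B_u\cap\{x:x_{i_u}>\theta_u\}$. An explainable clustering with $k$ clusters is the partition of $\mathcal{X}$ induced by the leaf regions of a threshold tree with $k$ leaves. The $k$-medians cost of a partition into clusters $C$ is $\sum_C\min_{c\in\mathbb{R}^d}\sum_{x\in C}\|x-c\|_1$; the optimal $k$-medians cost is the minimum over all partitions of $\mathcal{X}$ into at most $k$ clusters. *)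

theory Defs
  imports Complex_Main "HOL-Library.Disjoint_Sets"
begin

type_synonym point = "nat \<Rightarrow> real"

text \<open>Points of R^d are represented as functions nat => real that vanish at coordinates >= d;
  coordinates are 0-indexed, so the cut coordinate i ranges over i < d.\<close>

definition in_Rd :: "nat \<Rightarrow> point \<Rightarrow> bool" where
  "in_Rd d x \<longleftrightarrow> (\<forall>i\<ge>d. x i = 0)"

definition l1dist :: "nat \<Rightarrow> point \<Rightarrow> point \<Rightarrow> real" where
  "l1dist d x c = (\<Sum>i<d. \<bar>x i - c i\<bar>)"

definition cluster_cost :: "nat \<Rightarrow> point set \<Rightarrow> real" where
  "cluster_cost d C = (INF c \<in> {c. in_Rd d c}. (\<Sum>x\<in>C. l1dist d x c))"

datatype ttree = Leaf | Node nat real ttree ttree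

fun valid_tree :: "nat \<Rightarrow> ttree \<Rightarrow> bool" where
  "valid_tree d Leaf = True"
| "valid_tree d (Node i \<theta> l r) = (i < d \<and> valid_tree d l \<and> valid_tree d r)"

fun num_leaves :: "ttree \<Rightarrow> nat" where
  "num_leaves Leaf = 1"
| "num_leaves (Node i \<theta> l r) = num_leaves l + num_leaves r"

fun leaf_regions :: "ttree \<Rightarrow> point set \<Rightarrow> point set list" where
  "leaf_regions Leaf B = [B]"
| "leaf_regions (Node i \<theta> l r) B =
     leaf_regions l (B \<inter> {x. x i \<le> \<theta>}) @ leaf_regions r (B \<inter> {x. x i > \<theta>})"

definition tree_cost :: "nat \<Rightarrow> ttree \<Rightarrow> point set \<Rightarrow> real" where
  "tree_cost d t X = (\<Sum>B\<leftarrow>leaf_regions t UNIV. cluster_cost d (B \<inter> X))"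

definition opt_cost :: "nat \<Rightarrow> nat \<Rightarrow> point set \<Rightarrow> real" where
  "opt_cost d k X = (INF P \<in> {P. partition_on X P \<and> card P \<le> k}. (\<Sum>C\<in>P. cluster_cost d C))"

end

theory Submission
  imports Defs "HOL-Real_Asymp.Real_Asymp"
begin

text \<open>Take \<open>k - 1\<close> subsets \<open>S\<close> of \<open>{..<n}\<close> of size \<open>s\<close> such that no set of at most \<open>h\<close> elements
  meets them all. Put heavy clouds of points at the origin and at the indicator vectors of the
  sets \<open>S\<close>, and one light point at each unit vector. Using the clouds as clusters costs about
  \<open>n\<close>, with every unit vector at distance 1 from the origin. A tree with \<open>k\<close> leaves must separate
  the clouds, so the cuts on the path to the leaf of the origin form a hitting set, of size
  more than \<open>h\<close>; each cut coordinate sends its unit vector to the leaf of some \<open>S\<close>, at distance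
  at least \<open>s - 1\<close>. The ratio is about \<open>h * s / n\<close>. A greedy (averaging) choice
  of sets of density \<open>s / n = 1 / q\<close> achieves \<open>h\<close> close to \<open>q * ln k\<close> as \<open>q\<close> grows.\<close>

section \<open>Set families without small hitting sets\<close>

text \<open>Averaging: by double counting, some \<open>a\<close> is related to at least a
  \<rho>-fraction of the elements of \<open>B\<close> still uncovered, and each of the
  \<open>m\<close> rounds adds such an \<open>a\<close>. Later \<open>A\<close> holds candidate
  sets, \<open>B\<close> candidate hitting sets, and \<open>R\<close> is disjointness.\<close>

lemma greedy_cover:
  fixes R :: "'a \<Rightarrow> 'b \<Rightarrow> bool" and \<rho> :: real
  assumes "finite A" "finite B" "A \<noteq> {}"
    and deg: "\<And>b. b \<in> B \<Longrightarrow> real (card {a\<in>A. R a b}) \<ge> \<rho> * real (card A)"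
    and "\<rho> \<le> 1"
  shows "\<exists>F\<subseteq>A. card F \<le> m \<and>
           real (card {b\<in>B. \<forall>a\<in>F. \<not> R a b}) \<le> (1 - \<rho>) ^ m * real (card B)"
proof (induction m)
  case 0
  show ?case by (intro exI[of _ "{}"]) auto
next
  case (Suc m)
  then obtain F where F: "F \<subseteq> A" "card F \<le> m"
    and rest: "real (card {b\<in>B. \<forall>a\<in>F. \<not> R a b}) \<le> (1 - \<rho>) ^ m * real (card B)" by blast
  define U where "U = {b\<in>B. \<forall>a\<in>F. \<not> R a b}"
  have finU: "finite U" using assms(2) by (simp add: U_def)
  have "(\<Sum>a\<in>A. real (card {b\<in>U. R a b})) = (\<Sum>b\<in>U. real (card {a\<in>A. R a b}))"
  proof -
    have "(\<Sum>a\<in>A. real (card {b\<in>U. R a b})) = (\<Sum>a\<in>A. \<Sum>b\<in>U. of_bool (R a b))"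
      using finU by (intro sum.cong) (auto simp: of_bool_def sum.If_cases Int_def)
    also have "\<dots> = (\<Sum>b\<in>U. \<Sum>a\<in>A. of_bool (R a b))" by (rule sum.swap)
    also have "\<dots> = (\<Sum>b\<in>U. real (card {a\<in>A. R a b}))"
      using assms(1) by (intro sum.cong) (auto simp: of_bool_def sum.If_cases Int_def)
    finally show ?thesis .
  qed
  also have "\<dots> \<ge> (\<Sum>b\<in>U. \<rho> * real (card A))"
    using deg by (intro sum_mono) (auto simp: U_def)
  finally have avg: "(\<Sum>a\<in>A. real (card {b\<in>U. R a b})) \<ge> (\<Sum>a\<in>A. \<rho> * real (card U))"
    by (simp add: mult_ac)
  have "\<exists>a\<in>A. real (card {b\<in>U. R a b}) \<ge> \<rho> * real (card U)"
  proof (rule ccontr)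
    assume "\<not> ?thesis"
    then have "(\<Sum>a\<in>A. real (card {b\<in>U. R a b})) < (\<Sum>a\<in>A. \<rho> * real (card U))"
      using assms(1,3) by (intro sum_strict_mono) auto
    with avg show False by simp
  qed
  then obtain a where a: "a \<in> A" "real (card {b\<in>U. R a b}) \<ge> \<rho> * real (card U)" by blast
  have "{b\<in>B. \<forall>a\<in>insert a F. \<not> R a b} = U - {b\<in>U. R a b}"
    by (auto simp: U_def)
  then have "real (card {b\<in>B. \<forall>a\<in>insert a F. \<not> R a b}) = real (card U) - real (card {b\<in>U. R a b})"
    using finU by (simp add: card_Diff_subset card_mono of_nat_diff)
  also have "\<dots> \<le> (1 - \<rho>) * real (card U)" using a(2) by (simp add: algebra_simps)
  also have "\<dots> \<le> (1 - \<rho>) * ((1 - \<rho>) ^ m * real (card B))"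
    using rest \<open>\<rho> \<le> 1\<close> by (intro mult_left_mono) (auto simp: U_def)
  finally have "real (card {b\<in>B. \<forall>a\<in>insert a F. \<not> R a b}) \<le> (1 - \<rho>) ^ Suc m * real (card B)"
    by (simp add: mult_ac)
  moreover have "card (insert a F) \<le> Suc m"
    using F(2) card_insert_le_m1 finite_subset[OF F(1) assms(1)] by (simp add: card_insert_if)
  ultimately show ?case using F(1) a(1) by (intro exI[of _ "insert a F"]) auto
qed

text \<open>The ratio of the two binomials is the fraction of \<open>k\<close>-subsets of a
  \<open>q * k\<close>-set that avoid a fixed \<open>h\<close>-set. Deleting one element from a
  ground set of size \<open>Suc n\<close> multiplies the count by \<open>1 - k / Suc n\<close>, and
  \<open>Suc n \<ge> (q - 1) * k\<close> as long as fewer than \<open>k\<close> elements are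
  gone.\<close>

lemma binomial_diff_ge:
  assumes "q \<ge> 2" "h \<le> k" "k > 0"
  shows "real ((q * k - h) choose k) \<ge> (1 - 1 / (real q - 1)) ^ h * real ((q * k) choose k)"
  using assms(2)
proof (induction h)
  case 0
  show ?case by simp
next
  case (Suc h)
  define n where "n = q * k - Suc h"
  have "2 * k \<le> q * k" using assms(1) by simp
  then have n1: "q * k - h = Suc n" and nk: "k \<le> Suc n" using Suc.prems assms(3)
    unfolding n_def by linarith+
  have "real (Suc n) \<ge> (real q - 1) * real k"
  proof -
    have "real (q * k) = real (Suc n) + real h" using n1 Suc.prems \<open>2 * k \<le> q * k\<close> by linarith
    then show ?thesis using Suc.prems by (simp add: algebra_simps)
  qed
  then have f: "1 - 1 / (real q - 1) \<le> 1 - real k / real (Suc n)"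
    using assms(1,3) by (simp add: field_simps)
  have "(Suc n - k) * (Suc n choose k) = Suc n * (n choose k)"
  proof (cases "k \<le> n")
    case True
    then show ?thesis
      using binomial_absorb_comp[of "Suc n" k] by simp
  next
    case False
    with nk show ?thesis by (simp add: binomial_eq_0)
  qed
  then have "real (Suc n - k) * real (Suc n choose k) = real (Suc n) * real (n choose k)"
    by (metis of_nat_mult)
  then have "real (n choose k) = (1 - real k / real (Suc n)) * real (Suc n choose k)"
    using nk by (simp add: of_nat_diff field_simps del: of_nat_Suc)
  also have "\<dots> \<ge> (1 - 1 / (real q - 1)) * real (Suc n choose k)"
    using f by (intro mult_right_mono) auto
  finally have "real (n choose k) \<ge> (1 - 1 / (real q - 1)) * real (Suc n choose k)" .
  moreover have "(1 - 1 / (real q - 1)) * real (Suc n choose k)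
      \<ge> (1 - 1 / (real q - 1)) * ((1 - 1 / (real q - 1)) ^ h * real ((q * k) choose k))"
    using Suc n1 assms(1) by (intro mult_left_mono) auto
  ultimately show ?case by (simp add: n_def mult_ac)
qed

text \<open>After the greedy choice at most \<open>(q * k) ^ h * (1 - \<rho>) ^ (k - 1)\<close> of
  the \<open>h\<close>-sets hit every chosen set, where
  \<open>\<rho> = (1 - 1 / (q - 1)) ^ h\<close>. By \<open>small\<close> this count is below 1,
  hence 0.\<close>

lemma family_without_small_hitting_set:
  assumes q: "q \<ge> 2" and h: "h \<le> k" and k: "k > 1"
    and small: "real (q * k) ^ h * (1 - (1 - 1 / (real q - 1)) ^ h) ^ (k - 1) < 1"
  obtains F where "F \<subseteq> {S. S \<subseteq> {..<q * k} \<and> card S = k}" "card F = k - 1"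
    "\<And>H. H \<subseteq> {..<q * k} \<Longrightarrow> \<forall>S\<in>F. H \<inter> S \<noteq> {} \<Longrightarrow> h < card H"
proof -
  define A where "A = {S. S \<subseteq> {..<q * k} \<and> card S = k}"
  define B where "B = {H. H \<subseteq> {..<q * k} \<and> card H = h}"
  define \<rho> where "\<rho> = (1 - 1 / (real q - 1)) ^ h"
  have cardA: "card A = (q * k) choose k" and cardB: "card B = (q * k) choose h"
    by (simp_all add: A_def B_def n_subsets)
  have finA: "finite A" and finB: "finite B" by (auto simp: A_def B_def)
  have "k < q * k" using q k by simp
  then have big: "k \<le> card A" 
  proof -
    have "(q * k) choose 1 \<le> (q * k) choose k"
    proof (rule binomial_mono)
      show "1 \<le> k" using k by simp
      show "2 * k \<le> q * k" using q by simp
    qed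
    then have "q * k \<le> (q * k) choose k" by (simp only: choose_one)
    with \<open>k < q * k\<close> show ?thesis unfolding cardA by (meson less_imp_le order_trans)
  qed
  have deg: "real (card {S\<in>A. H \<inter> S = {}}) \<ge> \<rho> * real (card A)" if "H \<in> B" for H
  proof -
    have "{S\<in>A. H \<inter> S = {}} = {S. S \<subseteq> {..<q * k} - H \<and> card S = k}"
      by (auto simp: A_def)
    moreover have "card ({..<q * k} - H) = q * k - h"
      using that by (subst card_Diff_subset) (auto simp: B_def intro: finite_subset)
    ultimately have "card {S\<in>A. H \<inter> S = {}} = (q * k - h) choose k"
      by (simp add: n_subsets)
    then show ?thesis using binomial_diff_ge[OF q h] k by (simp add: \<rho>_def cardA)
  qed
  have \<rho>1: "\<rho> \<le> 1" using q by (auto simp: \<rho>_def intro!: power_le_one)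
  have "A \<noteq> {}" using big k by auto
  from greedy_cover[where R = "\<lambda>S H. H \<inter> S = {}" and m = "k - 1", OF finA finB this deg \<rho>1]
  obtain F0 where F0: "F0 \<subseteq> A" "card F0 \<le> k - 1" and
    rest: "real (card {H\<in>B. \<forall>S\<in>F0. H \<inter> S \<noteq> {}}) \<le> (1 - \<rho>) ^ (k - 1) * real (card B)"
    by auto
  have "real (card B) \<le> real (q * k) ^ h"
  proof -
    have "(q * k) choose h \<le> (q * k) ^ h"
      using le_trans[OF h less_imp_le[OF \<open>k < q * k\<close>]] by (rule binomial_le_pow)
    then show ?thesis unfolding cardB by (metis of_nat_le_iff of_nat_power)
  qed
  then have "(1 - \<rho>) ^ (k - 1) * real (card B) \<le> (1 - \<rho>) ^ (k - 1) * real (q * k) ^ h"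
    using \<rho>1 by (intro mult_left_mono) auto
  with rest small have "card {H\<in>B. \<forall>S\<in>F0. H \<inter> S \<noteq> {}} = 0"
    by (simp add: \<rho>_def mult_ac)
  then have none: "\<not> (\<forall>S\<in>F0. H \<inter> S \<noteq> {})" if "H \<in> B" for H
    using finB that by auto
  \<comment> \<open>The greedy family may be too small; padding it to \<open>k - 1\<close> sets only
    makes it harder to hit.\<close>
  obtain F where F: "F0 \<subseteq> F" "F \<subseteq> A" "card F = k - 1"
    using exists_subset_between[OF F0(2) le_trans[OF diff_le_self big] F0(1) finA] by blast
  have "h < card H" if H: "H \<subseteq> {..<q * k}" "\<forall>S\<in>F. H \<inter> S \<noteq> {}" for H
  proof (rule ccontr)
    assume "\<not> h < card H"
    \<comment> \<open>A smaller hitting set can be enlarged to size \<open>h\<close> and still hits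
      everything, so excluding size \<open>h\<close> suffices.\<close>
    then obtain H' where "H \<subseteq> H'" "H' \<subseteq> {..<q * k}" "card H' = h"
      using exists_subset_between[of H h "{..<q * k}"] H(1) le_trans[OF h less_imp_le[OF \<open>k < q * k\<close>]] \<open>\<not> h < card H\<close> by auto
    with none[of H'] H(2) F(1) show False by (auto simp: B_def) blast
  qed
  with F that show ?thesis by (auto simp: A_def)
qed

section \<open>Threshold trees and cluster costs\<close>

text \<open>Leaves are numbered from left to right, the order of \<open>leaf_regions\<close>, which
  turns regions into fibres of a function.\<close>

fun leaf_index :: "ttree \<Rightarrow> point \<Rightarrow> nat" where
  "leaf_index Leaf x = 0"
| "leaf_index (Node i \<theta> l r) x =
     (if x i \<le> \<theta> then leaf_index l x else num_leaves l + leaf_index r x)"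

fun cuts :: "ttree \<Rightarrow> (nat \<times> real) set" where
  "cuts Leaf = {}"
| "cuts (Node i \<theta> l r) = insert (i, \<theta>) (cuts l \<union> cuts r)"

fun path_cuts :: "ttree \<Rightarrow> point \<Rightarrow> (nat \<times> real) set" where
  "path_cuts Leaf x = {}"
| "path_cuts (Node i \<theta> l r) x =
     insert (i, \<theta>) (if x i \<le> \<theta> then path_cuts l x else path_cuts r x)"

lemma leaf_index_less: "leaf_index t x < num_leaves t"
  by (induction t) auto

lemma leaf_regions_eq:
  "leaf_regions t B = map (\<lambda>j. {x\<in>B. leaf_index t x = j}) [0..<num_leaves t]"
proof (induction t arbitrary: B)
  case Leaf
  then show ?case by simp
next
  case (Node i \<theta> l r)
  define f where "f j = {x\<in>B. leaf_index (Node i \<theta> l r) x = j}" for j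
  have f_left: "f j = {x \<in> B \<inter> {x. x i \<le> \<theta>}. leaf_index l x = j}" if "j < num_leaves l" for j
    using that by (auto simp: f_def)
  have f_right: "f (num_leaves l + j) = {x \<in> B \<inter> {x. x i > \<theta>}. leaf_index r x = j}" for j
  proof -
    have "leaf_index l x \<noteq> num_leaves l + j" for x using leaf_index_less[of l x] by simp
    then show ?thesis by (auto simp: f_def)
  qed
  have "leaf_regions (Node i \<theta> l r) B = map f [0..<num_leaves l + num_leaves r]"
    unfolding leaf_regions.simps Node.IH upt_add_eq_append[OF le0] map_append
    by (rule arg_cong2[where f = append]; rule nth_equalityI) (simp_all add: f_left f_right)
  then show ?case unfolding f_def num_leaves.simps .
qed

lemma tree_cost_eq:
  "tree_cost d t X = (\<Sum>j<num_leaves t. cluster_cost d {x\<in>X. leaf_index t x = j})"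
  unfolding tree_cost_def leaf_regions_eq
  by (simp add: sum_list_distinct_conv_sum_set comp_def lessThan_atLeast0 Int_def conj_commute)

lemma card_cuts: "finite (cuts t) \<and> card (cuts t) < num_leaves t"
proof (induction t)
  case (Node i \<theta> l r)
  then show ?case
    using card_Un_le[of "cuts l" "cuts r"] by (auto simp: card_insert_if)
qed simp

lemma path_cuts_subset: "path_cuts t x \<subseteq> cuts t"
  by (induction t) auto

lemma cuts_valid: "valid_tree d t \<Longrightarrow> (i, \<theta>) \<in> cuts t \<Longrightarrow> i < d"
  by (induction t) auto

text \<open>The point \<open>y\<close> stays with \<open>x\<close> until the first cut on the path
  of \<open>x\<close> where they differ; from there the indices differ, because left indices lie
  below \<open>num_leaves l\<close> and right ones do not.\<close>

lemma leaf_index_eq_iff: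
  "leaf_index t y = leaf_index t x \<longleftrightarrow> (\<forall>(i, \<theta>)\<in>path_cuts t x. y i \<le> \<theta> \<longleftrightarrow> x i \<le> \<theta>)"
proof (induction t)
  case (Node i \<theta> l r)
  then show ?case
    using leaf_index_less[of l x] leaf_index_less[of l y] by auto
qed simp

section \<open>Bounds for cluster costs and the optimal cost\<close>

lemma l1dist_nonneg: "0 \<le> l1dist d x c"
  by (simp add: l1dist_def sum_nonneg)

lemma l1dist_triangle: "l1dist d x y \<le> l1dist d x c + l1dist d y c"
  unfolding l1dist_def sum.distrib[symmetric] by (intro sum_mono) auto

lemma in_Rd_zero: "in_Rd d (\<lambda>_. 0)"
  by (simp add: in_Rd_def)

lemma cluster_cost_ge:
  assumes "\<And>c. in_Rd d c \<Longrightarrow> v \<le> (\<Sum>x\<in>C. l1dist d x c)"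
  shows "v \<le> cluster_cost d C"
  unfolding cluster_cost_def using assms in_Rd_zero by (intro cINF_greatest) auto

lemma cluster_cost_nonneg: "0 \<le> cluster_cost d C"
  by (intro cluster_cost_ge sum_nonneg l1dist_nonneg)

lemma cluster_cost_le:
  assumes "in_Rd d c"
  shows "cluster_cost d C \<le> (\<Sum>x\<in>C. l1dist d x c)"
  unfolding cluster_cost_def
  using assms by (intro cINF_lower bdd_belowI2[where m = 0] sum_nonneg l1dist_nonneg) auto

text \<open>Whatever the center \<open>c\<close>, the triangle inequality charges at least
  \<open>v\<close> to each pair \<open>f i\<close>, \<open>g i\<close>, and the pairs are disjoint.
  This gives lower bounds without knowledge of the best center.\<close>

lemma cluster_cost_matching:
  assumes "finite C" "finite I" "inj_on f I" "inj_on g I" "f ` I \<union> g ` I \<subseteq> C" "f ` I \<inter> g ` I = {}"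
    and dist: "\<And>i. i \<in> I \<Longrightarrow> l1dist d (f i) (g i) \<ge> v"
  shows "real (card I) * v \<le> cluster_cost d C"
proof (rule cluster_cost_ge)
  fix c assume "in_Rd d c"
  have "real (card I) * v = (\<Sum>i\<in>I. v)" by simp
  also have "\<dots> \<le> (\<Sum>i\<in>I. l1dist d (f i) c + l1dist d (g i) c)"
    using dist l1dist_triangle by (intro sum_mono) (meson order_trans)
  also have "\<dots> = (\<Sum>x\<in>f ` I \<union> g ` I. l1dist d x c)"
    using assms by (subst sum.union_disjoint) (auto simp: sum.distrib sum.reindex)
  also have "\<dots> \<le> (\<Sum>x\<in>C. l1dist d x c)"
    using assms by (intro sum_mono2 l1dist_nonneg) auto
  finally show "real (card I) * v \<le> (\<Sum>x\<in>C. l1dist d x c)" .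
qed

lemma opt_cost_le:
  assumes "partition_on X P" "card P \<le> k"
  shows "opt_cost d k X \<le> (\<Sum>C\<in>P. cluster_cost d C)"
  unfolding opt_cost_def using assms
  by (intro cINF_lower bdd_belowI2[where m = 0] sum_nonneg cluster_cost_nonneg) auto

text \<open>By pigeonhole some cluster contains two points, and that pair alone costs \<eta>. This
  will show that the optimum of the instance is positive.\<close>

lemma opt_cost_ge:
  assumes "finite X" "k < card X" "0 < k"
    and sep: "\<And>x y. x \<in> X \<Longrightarrow> y \<in> X \<Longrightarrow> x \<noteq> y \<Longrightarrow> \<eta> \<le> l1dist d x y"
  shows "\<eta> \<le> opt_cost d k X"
  unfolding opt_cost_def
proof (rule cINF_greatest)
  have "partition_on X {X}" using assms(2) by (auto simp: partition_on_def disjoint_def)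
  then show "{P. partition_on X P \<and> card P \<le> k} \<noteq> {}"
    using assms(3) by (auto intro!: exI[of _ "{X}"])
next
  fix P assume "P \<in> {P. partition_on X P \<and> card P \<le> k}"
  then have P: "partition_on X P" "card P \<le> k" by auto
  have finP: "finite P" using finite_elements[OF assms(1) P(1)] .
  have "\<exists>C\<in>P. card C > 1"
  proof (rule ccontr)
    assume "\<not> ?thesis"
    then have "card (\<Union>P) \<le> (\<Sum>C\<in>P. 1)"
      using card_Union_le_sum_card[of P] sum_mono[of P card "\<lambda>_. 1"] by (meson not_le order_trans)
    with P assms(2) show False by (simp add: partition_on_def)
  qed
  then obtain C where C: "C \<in> P" "card C > 1" by blast
  then obtain x y where xy: "x \<in> C" "y \<in> C" "x \<noteq> y"
    by (metis One_nat_def card_le_Suc0_iff_eq card.infinite not_less not_one_less_zero less_imp_not_less)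
  have CX: "C \<subseteq> X" using C(1) P(1) by (auto simp: partition_on_def)
  have "real (card {()}) * \<eta> \<le> cluster_cost d C"
    using CX xy sep assms(1)
    by (intro cluster_cost_matching[where f = "\<lambda>_. x" and g = "\<lambda>_. y"]) (auto intro: finite_subset)
  also have "\<dots> \<le> (\<Sum>C\<in>P. cluster_cost d C)"
    using finP C(1) by (intro member_le_sum cluster_cost_nonneg) auto
  finally show "\<eta> \<le> (\<Sum>C\<in>P. cluster_cost d C)" by simp
qed

section \<open>The instance of a set family\<close>

text \<open>The indicator vector of \<open>S\<close> in the first \<open>n\<close> coordinates, with
  a spare coordinate \<open>n\<close> that tells the points of one cloud apart.\<close>

definition pt :: "nat \<Rightarrow> nat set \<Rightarrow> real \<Rightarrow> point" where
  "pt n S y = (\<lambda>i. if i < n then of_bool (i \<in> S) else if i = n then y else 0)"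

lemma pt_simps: "i < n \<Longrightarrow> pt n S y i = of_bool (i \<in> S)" "pt n S y n = y"
  by (simp_all add: pt_def)

lemma in_Rd_pt: "in_Rd (Suc n) (pt n S y)"
  by (simp add: in_Rd_def pt_def)

lemma l1dist_pt:
  assumes "S \<subseteq> {..<n}" "T \<subseteq> {..<n}"
  shows "l1dist (Suc n) (pt n S y) (pt n T z) = real (card (sym_diff S T)) + \<bar>y - z\<bar>"
proof -
  have "(\<Sum>i<n. \<bar>pt n S y i - pt n T z i\<bar>) = (\<Sum>i<n. of_bool (i \<in> sym_diff S T))"
    by (intro sum.cong) (auto simp: pt_def)
  also have "\<dots> = real (card (sym_diff S T))"
    using assms by (auto simp: of_bool_def sum.If_cases intro!: arg_cong[where f = card])
  finally show ?thesis by (simp add: l1dist_def pt_simps)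
qed

lemma pt_eq_iff:
  assumes "S \<subseteq> {..<n}" "T \<subseteq> {..<n}"
  shows "pt n S y = pt n T z \<longleftrightarrow> S = T \<and> y = z"
proof
  assume eq: "pt n S y = pt n T z"
  have "i \<in> S \<longleftrightarrow> i \<in> T" if "i < n" for i
    using fun_cong[OF eq, of i] that by (simp add: pt_simps of_bool_eq_iff)
  moreover have "y = z" using fun_cong[OF eq, of n] by (simp add: pt_simps)
  ultimately show "S = T \<and> y = z" using assms by (auto simp: subset_iff)
qed simp

lemma l1dist_pt_ge_1:
  assumes "S \<subseteq> {..<n}" "T \<subseteq> {..<n}" "S \<noteq> T"
  shows "1 \<le> l1dist (Suc n) (pt n S y) (pt n T z)"
proof -
  have "finite (sym_diff S T)"
    using assms by (meson finite_Diff finite_Un finite_lessThan finite_subset)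
  moreover have "sym_diff S T \<noteq> {}" using assms(3) by blast
  ultimately have "1 \<le> card (sym_diff S T)" by (simp add: Suc_le_eq card_gt_0_iff)
  then have "1 \<le> real (card (sym_diff S T))" by linarith
  then show ?thesis unfolding l1dist_pt[OF assms(1,2)] by linarith
qed

text \<open>The \<open>k - 1\<close> sets and the origin make \<open>k\<close> centers.
  \<open>L\<close> is the length of a block of cloud points; \<open>n \<le> L\<close> lets each unit
  vector have its own partner in a block.\<close>

locale set_family_instance =
  fixes n k s h L :: nat and F :: "nat set set"
  assumes F_sub: "F \<subseteq> Pow {..<n}" and card_F: "card F = k - 1" and k_pos: "k \<ge> 1"
    and large: "\<And>S. S \<in> F \<Longrightarrow> s \<le> card S" and s2: "s \<ge> 2"
    and hitting: "\<And>H. H \<subseteq> {..<n} \<Longrightarrow> \<forall>S\<in>F. H \<inter> S \<noteq> {} \<Longrightarrow> h < card H"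
    and L: "n \<le> L" "2 \<le> L"
begin

definition centers where "centers = insert {} F"

text \<open>The cloud of a center consists of \<^term>\<open>k * L\<close> points that differ only in coordinate
  \<^term>\<open>n\<close>, at spacing \<open>\<eta>\<close>; the spacing makes the total cost of the clouds at most 1. Clouds
  replace points of high multiplicity, which a point set cannot have.\<close>

definition \<eta> :: real where "\<eta> = 1 / (real k * (real k * real L)\<^sup>2)"

definition cloud_pt :: "nat set \<Rightarrow> nat \<Rightarrow> point" where
  "cloud_pt S p = pt n S (real p * \<eta>)"

definition unit_pt :: "nat \<Rightarrow> point" where "unit_pt i = pt n {i} 0"

definition cloud where "cloud S = cloud_pt S ` {..<k * L}"

definition X where "X = unit_pt ` {..<n} \<union> \<Union> (cloud ` centers)"

lemma \<eta>_pos: "\<eta> > 0" using k_pos L by (simp add: \<eta>_def)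

lemma \<eta>_le: "\<eta> \<le> 1"
proof -
  have "1 \<le> real k" "1 \<le> real L" using k_pos L by auto
  then have "1 \<le> real k * (real k * real L)\<^sup>2"
    using mult_mono[of 1 "real k" 1 "(real k * real L)\<^sup>2"] mult_mono[of 1 "real k" 1 "real L"]
    by (simp add: one_le_power)
  then show ?thesis by (simp add: \<eta>_def divide_le_eq)
qed

lemma finite_F: "finite F" using F_sub finite_subset by blast

lemma empty_notin_F: "{} \<notin> F" using large s2 by force

lemma card_ge2: "S \<in> centers \<Longrightarrow> S \<noteq> {} \<Longrightarrow> 2 \<le> card S"
  using large s2 by (force simp: centers_def)

lemma card_centers: "finite centers" "card centers = k"
  using finite_F empty_notin_F card_F k_pos by (auto simp: centers_def)

lemma centers_sub: "S \<in> centers \<Longrightarrow> S \<subseteq> {..<n}"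
  using F_sub by (auto simp: centers_def)

lemma cloud_pt_eq_iff:
  "S \<in> centers \<Longrightarrow> T \<in> centers \<Longrightarrow> cloud_pt S p = cloud_pt T r \<longleftrightarrow> S = T \<and> p = r"
  using \<eta>_pos centers_sub by (simp add: cloud_pt_def pt_eq_iff)

text \<open>Nonempty centers have at least two elements, so no center is a singleton.\<close>

lemma unit_pt_neq_cloud_pt:
  assumes "i < n" "S \<in> centers"
  shows "unit_pt i \<noteq> cloud_pt S p"
proof -
  have "S \<noteq> {i}" using card_ge2[OF assms(2)] by auto
  then show ?thesis using assms centers_sub by (auto simp: unit_pt_def cloud_pt_def pt_eq_iff)
qed

lemma unit_pt_inj: "inj_on unit_pt {..<n}"
  by (auto simp: inj_on_def unit_pt_def pt_eq_iff)

lemma finite_X: "finite X"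
  using card_centers by (simp add: X_def cloud_def)

lemma in_Rd_X: "x \<in> X \<Longrightarrow> in_Rd (Suc n) x"
  by (auto simp: X_def cloud_def cloud_pt_def unit_pt_def in_Rd_pt)

lemma X_cases:
  assumes "x \<in> X"
  obtains S p where "x = pt n S (real p * \<eta>)" "S \<subseteq> {..<n}"
proof (cases "x \<in> unit_pt ` {..<n}")
  case True
  then obtain i where "i < n" "x = pt n {i} (real 0 * \<eta>)" by (auto simp: unit_pt_def)
  then show ?thesis by (intro that[of "{i}" 0]) auto
next
  case False
  then show ?thesis using assms centers_sub that by (auto simp: X_def cloud_def cloud_pt_def)
qed

text \<open>Points over the same set differ in coordinate \<open>n\<close> by a nonzero multiple of
  \<eta>; points over different sets are at distance at least 1.\<close>

lemma X_separated:
  assumes "x \<in> X" "y \<in> X" "x \<noteq> y"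
  shows "\<eta> \<le> l1dist (Suc n) x y"
proof -
  obtain S p where x: "x = pt n S (real p * \<eta>)" "S \<subseteq> {..<n}" using X_cases[OF assms(1)] .
  obtain T r where y: "y = pt n T (real r * \<eta>)" "T \<subseteq> {..<n}" using X_cases[OF assms(2)] .
  show ?thesis
  proof (cases "S = T")
    case True
    then have "p \<noteq> r" using assms(3) x(1) y(1) by auto
    then have "1 \<le> \<bar>real p - real r\<bar>" by linarith
    then have "1 * \<eta> \<le> \<bar>real p - real r\<bar> * \<eta>" using \<eta>_pos by (intro mult_right_mono) auto
    also have "\<dots> = \<bar>real p * \<eta> - real r * \<eta>\<bar>"
      using \<eta>_pos by (simp add: left_diff_distrib[symmetric] abs_mult)
    finally show ?thesis unfolding x(1) y(1) l1dist_pt[OF x(2) y(2)] using True by simp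
  next
    case False
    with l1dist_pt_ge_1[OF x(2) y(2)] \<eta>_le show ?thesis unfolding x(1) y(1) by (meson order_trans)
  qed
qed

lemma card_X: "k < card X"
proof -
  define I where "I = (\<lambda>(S, p). cloud_pt S p) ` (centers \<times> {..<k * L})"
  have "card I = k * (k * L)"
    unfolding I_def using card_centers
    by (subst card_image) (auto simp: inj_on_def cloud_pt_eq_iff card_cartesian_product)
  moreover have "I \<subseteq> X" by (auto simp: I_def X_def cloud_def)
  ultimately have "k * (k * L) \<le> card X" using finite_X card_mono by metis
  moreover have "k * 1 < k * (k * L)"
  proof -
    have "1 * 2 \<le> k * L" using k_pos L by (intro mult_le_mono) auto
    then show ?thesis using k_pos by (subst mult_less_cancel1) auto
  qed
  ultimately show ?thesis unfolding mult_1_right by (rule less_le_trans[rotated])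
qed

section \<open>Positivity and upper bound of the optimal cost\<close>

lemma opt_pos: "0 < opt_cost (Suc n) k X"
  using opt_cost_ge[OF finite_X card_X _ X_separated] k_pos \<eta>_pos by fastforce

text \<open>At most \<open>k * L\<close> points, each within \<open>k * L * \<eta>\<close> of the
  first one; \<eta> is defined so that the product is \<open>1 / k\<close>.\<close>

lemma cloud_cost:
  assumes "S \<in> centers"
  shows "(\<Sum>x\<in>cloud S. l1dist (Suc n) x (cloud_pt S 0)) \<le> 1 / real k"
proof -
  have "(\<Sum>x\<in>cloud S. l1dist (Suc n) x (cloud_pt S 0)) \<le> (\<Sum>x\<in>cloud S. real (k * L) * \<eta>)"
  proof (rule sum_mono)
    fix x assume "x \<in> cloud S"
    then obtain p where p: "p < k * L" "x = cloud_pt S p" by (auto simp: cloud_def)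
    have "real p \<le> real (k * L)" using p(1) by (intro of_nat_mono) simp
    then have "real p * \<eta> \<le> real (k * L) * \<eta>" using \<eta>_pos by (intro mult_right_mono) auto
    then show "l1dist (Suc n) x (cloud_pt S 0) \<le> real (k * L) * \<eta>"
      using centers_sub[OF assms] \<eta>_pos by (simp add: p(2) cloud_pt_def l1dist_pt)
  qed
  also have "\<dots> \<le> real (k * L) * (real (k * L) * \<eta>)"
  proof -
    have "card (cloud S) \<le> k * L"
      unfolding cloud_def using card_image_le[of "{..<k * L}" "cloud_pt S"] by simp
    then have "real (card (cloud S)) \<le> real (k * L)" by (rule of_nat_mono)
    then show ?thesis using \<eta>_pos by (simp only: sum_constant) (intro mult_right_mono, auto)
  qed
  also have "\<dots> = 1 / real k"
    using k_pos L by (simp add: \<eta>_def power2_eq_square field_simps)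
  finally show ?thesis .
qed

lemma opt_le: "opt_cost (Suc n) k X \<le> real n + 1"
proof -
  \<comment> \<open>The clouds are the clusters, and the origin's cloud also takes all unit
    vectors.\<close>
  define C where "C S = (if S = {} then cloud {} \<union> unit_pt ` {..<n} else cloud S)" for S
  have disj: "cloud S \<inter> cloud T = {}" if "S \<in> centers" "T \<in> centers" "S \<noteq> T" for S T
    using that by (auto simp: cloud_def cloud_pt_eq_iff)
  have disj': "cloud S \<inter> unit_pt ` {..<n} = {}" if "S \<in> centers" for S
    using that by (auto simp: cloud_def) (metis unit_pt_neq_cloud_pt)
  have e: "{} \<in> centers" by (simp add: centers_def)
  have ne: "cloud S \<noteq> {}" for S using k_pos L by (auto simp: cloud_def lessThan_empty_iff)
  have CC: "C S \<inter> C T = {}" if "S \<in> centers" "T \<in> centers" "S \<noteq> T" for S T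
    using that disj[OF that] disj'[OF that(1)] disj'[OF that(2)] by (auto simp: C_def)
  have inj: "inj_on C centers"
  proof (rule inj_onI)
    fix S T assume "S \<in> centers" "T \<in> centers" "C S = C T"
    moreover have "C S \<noteq> {}" using ne by (simp add: C_def)
    ultimately show "S = T" using CC[of S T] by auto
  qed
  have "partition_on X (C ` centers)"
  proof (rule partition_onI)
    show "\<Union> (C ` centers) = X" using e by (auto simp: X_def C_def)
  next
    fix p q assume "p \<in> C ` centers" "q \<in> C ` centers" "p \<noteq> q"
    then show "disjnt p q" using CC by (auto simp: disjnt_def)
  next
    show "{} \<notin> C ` centers" using ne by (auto simp: C_def)
  qed
  moreover have "card (C ` centers) \<le> k"
    using card_image_le[OF card_centers(1)] card_centers(2) by metis
  ultimately have "opt_cost (Suc n) k X \<le> (\<Sum>K\<in>C ` centers. cluster_cost (Suc n) K)"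
    by (rule opt_cost_le)
  also have "\<dots> = (\<Sum>S\<in>centers. cluster_cost (Suc n) (C S))"
    using inj by (simp add: sum.reindex)
  also have "\<dots> \<le> (\<Sum>S\<in>centers. 1 / real k + (if S = {} then real n else 0))"
  proof (rule sum_mono)
    fix S assume S: "S \<in> centers"
    have "cluster_cost (Suc n) (C S) \<le> (\<Sum>x\<in>C S. l1dist (Suc n) x (cloud_pt S 0))"
      by (intro cluster_cost_le) (simp add: cloud_pt_def in_Rd_pt)
    also have "\<dots> \<le> 1 / real k + (if S = {} then real n else 0)"
    proof (cases "S = {}")
      case True
      have "(\<Sum>x\<in>unit_pt ` {..<n}. l1dist (Suc n) x (cloud_pt {} 0)) = (\<Sum>i<n. 1)"
        unfolding sum.reindex[OF unit_pt_inj]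
        by (intro sum.cong) (auto simp: unit_pt_def cloud_pt_def l1dist_pt)
      moreover have "(\<Sum>x\<in>C S. l1dist (Suc n) x (cloud_pt S 0)) =
          (\<Sum>x\<in>cloud {}. l1dist (Suc n) x (cloud_pt {} 0)) +
          (\<Sum>x\<in>unit_pt ` {..<n}. l1dist (Suc n) x (cloud_pt {} 0))"
        using disj'[OF e] True by (simp add: C_def cloud_def sum.union_disjoint)
      ultimately show ?thesis using cloud_cost[OF e] True by simp
    next
      case False
      then show ?thesis using cloud_cost[OF S] by (simp add: C_def)
    qed
    finally show "cluster_cost (Suc n) (C S) \<le> 1 / real k + (if S = {} then real n else 0)" .
  qed
  also have "\<dots> = real n + 1"
    using card_centers e k_pos by (simp add: sum.distrib)
  finally show ?thesis .
qed

text \<open>Disjoint blocks of \<^term>\<open>L\<close> positions: a threshold falls inside at most one of them, and a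
  tree with \<^term>\<open>k\<close> leaves has fewer than \<^term>\<open>k\<close> thresholds.\<close>

lemma uncut_block:
  assumes "num_leaves t = k"
  shows "\<exists>b<k. \<forall>\<theta> p r. (n, \<theta>) \<in> cuts t \<and> p < L \<and> r < L \<longrightarrow>
       (real (b * L + p) * \<eta> \<le> \<theta> \<longleftrightarrow> real (b * L + r) * \<eta> \<le> \<theta>)"
proof -
  \<comment> \<open>The index of the interval of length \<open>\<eta> * L\<close> containing the
    threshold. Cuts in other coordinates and negative thresholds, sent to 0 by \<open>nat\<close>,
    at worst use up a block each, so the count stays below \<open>k\<close>.\<close>
  define block where "block = (\<lambda>(i :: nat, \<theta>). nat \<lfloor>\<theta> / (\<eta> * real L)\<rfloor>)"
  have "card (block ` cuts t) < k"
    using card_cuts[of t] assms card_image_le[of "cuts t" block] by linarith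
  then have "\<not> {..<k} \<subseteq> block ` cuts t"
    using card_cuts[of t] card_mono[of "block ` cuts t" "{..<k}"] by auto
  then obtain b where b: "b < k" "b \<notin> block ` cuts t" by auto
  have "b = block (n, \<theta>)" if "p < L" "r < L" "real (b * L + p) * \<eta> \<le> \<theta>" "\<not> real (b * L + r) * \<eta> \<le> \<theta>"
    for \<theta> p r
  proof -
    have "real (b * L) * \<eta> \<le> real (b * L + p) * \<eta>" using \<eta>_pos by (intro mult_right_mono) auto
    with that(3) have "real b * (\<eta> * real L) \<le> \<theta>" by (simp add: mult_ac)
    moreover have "real (b * L + r) * \<eta> \<le> real (b * L + L) * \<eta>"
      using \<eta>_pos that(2) by (intro mult_right_mono) auto
    with that(4) have "\<theta> < (real b + 1) * (\<eta> * real L)" by (simp add: algebra_simps)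
    ultimately have "real b \<le> \<theta> / (\<eta> * real L)" "\<theta> / (\<eta> * real L) < real b + 1"
      using \<eta>_pos L by (simp_all add: le_divide_eq divide_less_eq)
    then have "\<lfloor>\<theta> / (\<eta> * real L)\<rfloor> = int b" by (intro floor_unique) auto
    then show ?thesis by (simp add: block_def)
  qed
  with b show ?thesis by (metis image_eqI)
qed

text \<open>If two centers share a leaf, their uncut blocks give \<open>L\<close> disjoint pairs at
  distance at least 1. Otherwise leaves and centers correspond, and the cuts on the origin's path
  yield more than \<open>h\<close> displaced unit vectors, each costing at least
  \<open>s - 1\<close>.\<close>

lemma tree_cost_ge:
  assumes valid: "valid_tree (Suc n) t" and leaves: "num_leaves t = k"
  shows "min (real L) ((real h + 1) * (real s - 1)) \<le> tree_cost (Suc n) t X"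
proof -
  obtain b where b: "b < k" "\<forall>\<theta> p r. (n, \<theta>) \<in> cuts t \<and> p < L \<and> r < L \<longrightarrow>
       (real (b * L + p) * \<eta> \<le> \<theta> \<longleftrightarrow> real (b * L + r) * \<eta> \<le> \<theta>)"
    using uncut_block[OF leaves] by blast
  \<comment> \<open>Only the points of the uncut block \<open>b\<close> are used, so each center
    behaves like one point of multiplicity \<open>L\<close>.\<close>
  define P where "P S p = cloud_pt S (b * L + p)" for S p
  define R where "R j = {x\<in>X. leaf_index t x = j}" for j
  define leaf where "leaf S = leaf_index t (P S 0)" for S
  have finR: "finite (R j)" for j using finite_X by (simp add: R_def)
  have "(b + 1) * L \<le> k * L" using b(1) by (intro mult_le_mono) auto
  then have PX: "P S p \<in> X" if "S \<in> centers" "p < L" for S p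
  proof -
    have "b * L + p < k * L" using \<open>(b + 1) * L \<le> k * L\<close> that(2) by (simp add: algebra_simps)
    with that(1) show ?thesis unfolding X_def cloud_def P_def by blast
  qed
  have same: "leaf_index t (P S p) = leaf S" if "S \<in> centers" "p < L" for S p
  proof -
    have "P S p i \<le> \<theta> \<longleftrightarrow> P S 0 i \<le> \<theta>" if "(i, \<theta>) \<in> cuts t" for i \<theta>
    proof (cases "i = n")
      case True
      then show ?thesis using b(2)[rule_format, of \<theta> p 0] that \<open>p < L\<close> by (simp add: P_def cloud_pt_def pt_simps)
    next
      case False
      then show ?thesis by (simp add: P_def cloud_pt_def pt_def)
    qed
    then show ?thesis unfolding leaf_def leaf_index_eq_iff using path_cuts_subset by blast
  qed
  have PR: "P S p \<in> R (leaf S)" if "S \<in> centers" "p < L" for S p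
    using PX same that by (simp add: R_def)
  have P_eq: "P S p = P T r \<longleftrightarrow> S = T \<and> p = r" if "S \<in> centers" "T \<in> centers" for S T p r
    using that by (simp add: P_def cloud_pt_eq_iff)
  have leaf_less: "leaf S < k" for S using leaf_index_less leaves by (auto simp: leaf_def)
  have cost: "tree_cost (Suc n) t X = (\<Sum>j<k. cluster_cost (Suc n) (R j))"
    by (simp add: tree_cost_eq leaves R_def)
  show ?thesis
  proof (cases "inj_on leaf centers")
    case False
    then obtain S T where ST: "S \<in> centers" "T \<in> centers" "S \<noteq> T" "leaf S = leaf T"
      by (auto simp: inj_on_def)
    have "1 \<le> l1dist (Suc n) (P S p) (P T p)" for p
      unfolding P_def cloud_pt_def using ST centers_sub by (intro l1dist_pt_ge_1) auto
    then have "real (card {..<L}) * 1 \<le> cluster_cost (Suc n) (R (leaf S))"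
      using ST PR[of S] PR[of T] finR
      by (intro cluster_cost_matching[where f = "P S" and g = "P T"]) (auto simp: inj_on_def P_eq)
    also have "\<dots> \<le> tree_cost (Suc n) t X"
      unfolding cost using leaf_less by (intro member_le_sum cluster_cost_nonneg) auto
    finally show ?thesis by simp
  next
    case True
    have onto: "leaf ` centers = {..<k}"
      using True card_centers leaf_less by (intro card_subset_eq) (auto simp: card_image)
    have e: "{} \<in> centers" by (simp add: centers_def)
    \<comment> \<open>Thresholds in \<open>[0, 1)\<close> are those separating the coordinate values
      0 and 1.\<close>
    define H where "H = {i. i < n \<and> (\<exists>\<theta>. (i, \<theta>) \<in> path_cuts t (P {} 0) \<and> 0 \<le> \<theta> \<and> \<theta> < 1)}"
    have "H \<inter> S \<noteq> {}" if "S \<in> F" for S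
    proof -
      have S: "S \<in> centers" "S \<noteq> {}" using that empty_notin_F by (auto simp: centers_def)
      then have "leaf S \<noteq> leaf {}" using True e by (auto simp: inj_on_def)
      then obtain i \<theta> where i: "(i, \<theta>) \<in> path_cuts t (P {} 0)"
        "\<not> (P S 0 i \<le> \<theta> \<longleftrightarrow> P {} 0 i \<le> \<theta>)"
        unfolding leaf_def leaf_index_eq_iff by blast
      have "i < Suc n" using i(1) path_cuts_subset cuts_valid[OF valid] by blast
      \<comment> \<open>\<open>P S 0\<close> and \<open>P {} 0\<close> have the same position in
        their clouds, hence the same coordinate \<open>n\<close>.\<close>
      moreover have "i \<noteq> n" using i(2) by (auto simp: P_def cloud_pt_def pt_simps)
      ultimately have "i < n" by simp
      then have "i \<in> S" "0 \<le> \<theta>" "\<theta> < 1"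
        using i(2) by (auto simp: P_def cloud_pt_def pt_simps of_bool_def split: if_splits)
      with i(1) \<open>i < n\<close> show ?thesis unfolding H_def by blast
    qed
    then have cardH: "h < card H" by (intro hitting) (auto simp: H_def)
    have finH: "finite H" and Hn: "H \<subseteq> {..<n}" by (auto simp: H_def)
    have away: "leaf_index t (unit_pt i) \<noteq> leaf {}" if iH: "i \<in> H" for i
    proof -
      obtain \<theta> where "i < n" "(i, \<theta>) \<in> path_cuts t (P {} 0)" "0 \<le> \<theta>" "\<theta> < 1"
        using iH unfolding H_def by blast
      then show ?thesis
        unfolding leaf_def leaf_index_eq_iff
        by (auto simp: P_def cloud_pt_def unit_pt_def pt_simps intro!: bexI[of _ "(i, \<theta>)"])
    qed
    have leaf_cost: "real (card {i\<in>H. leaf_index t (unit_pt i) = j}) * (real s - 1)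
        \<le> cluster_cost (Suc n) (R j)" if jk: "j < k" for j
    proof (cases "j = leaf {}")
      case True
      then have "{i\<in>H. leaf_index t (unit_pt i) = j} = {}" using away by auto
      then show ?thesis by (simp only: card.empty of_nat_0 mult_zero_left cluster_cost_nonneg)
    next
      case False
      obtain S where S: "S \<in> centers" "j = leaf S" using onto jk by blast
      with False have SF: "S \<in> F" by (auto simp: centers_def)
      \<comment> \<open>Unit vector \<open>i\<close> is paired with position \<open>i\<close> of the
        block. It shares at most one element with \<open>S\<close>, and coordinate \<open>n\<close>
        can only add to the distance.\<close>
      have dist: "real s - 1 \<le> l1dist (Suc n) (unit_pt i) (P S i)" if "i < n" for i
      proof -
        have "finite S" using S(1) centers_sub finite_subset by blast
        have "real s - 1 \<le> real (card (S - {i}))"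
          using large[OF SF] diff_card_le_card_Diff[of "{i}" S] by simp
        also have "\<dots> \<le> real (card (sym_diff {i} S))"
          using \<open>finite S\<close> by (intro of_nat_mono card_mono) auto
        also have "\<dots> \<le> l1dist (Suc n) (unit_pt i) (P S i)"
          using that centers_sub[OF S(1)] by (simp add: unit_pt_def P_def cloud_pt_def l1dist_pt)
        finally show ?thesis .
      qed
      define I where "I = {i\<in>H. leaf_index t (unit_pt i) = j}"
      have I: "I \<subseteq> {..<n}" "finite I" using Hn finH by (auto simp: I_def)
      have "P S i \<in> R j" if "i \<in> I" for i using PR[OF S(1), of i] S(2) L I(1) that by auto
      moreover have "unit_pt i \<in> R j" if "i \<in> I" for i
        using that Hn by (auto simp: I_def R_def X_def)
      ultimately have sub: "unit_pt ` I \<union> P S ` I \<subseteq> R j" by blast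
      have disj: "unit_pt ` I \<inter> P S ` I = {}"
        using I(1) unit_pt_neq_cloud_pt[OF _ S(1)] unfolding P_def by blast
      have injs: "inj_on unit_pt I" "inj_on (P S) I"
        using inj_on_subset[OF unit_pt_inj I(1)] S(1) by (auto simp: inj_on_def P_eq)
      show ?thesis
        unfolding I_def[symmetric]
        using dist I(1) by (intro cluster_cost_matching[OF finR I(2) injs sub disj]) auto
    qed
    have "card H = (\<Sum>j<k. card {i\<in>H. leaf_index t (unit_pt i) = j})"
      using sum.group[OF finH, of "{..<k}" "\<lambda>i. leaf_index t (unit_pt i)" "\<lambda>_. 1 :: nat"]
        leaf_index_less[of t] leaves by (simp add: image_subset_iff)
    then have "real (card H) * (real s - 1) =
        (\<Sum>j<k. real (card {i\<in>H. leaf_index t (unit_pt i) = j}) * (real s - 1))"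
      by (simp add: sum_distrib_right)
    also have "\<dots> \<le> tree_cost (Suc n) t X"
      unfolding cost using leaf_cost by (intro sum_mono) auto
    finally have "real (card H) * (real s - 1) \<le> tree_cost (Suc n) t X" .
    moreover have "(real h + 1) * (real s - 1) \<le> real (card H) * (real s - 1)"
      using cardH s2 by (intro mult_right_mono) auto
    ultimately show ?thesis by linarith
  qed
qed

end

section \<open>Asymptotic choice of the parameters\<close>

text \<open>With \<open>h\<close> about \<open>a * ln k\<close> and
  \<open>a = (1 - \<epsilon> / 2) * q\<close>, the avoiding fraction \<rho> is at least
  \<open>k\<close> to the power \<open>-(1 - \<epsilon> / 4)\<close>. So
  \<open>\<rho> * (k - 1)\<close> outgrows \<open>h * ln (q * k)\<close>, while the cost ratio tends
  to \<open>(1 - \<epsilon> / 2) * ln k\<close>.\<close>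

lemma parameters_exist:
  fixes \<epsilon> :: real
  assumes "0 < \<epsilon>" "\<epsilon> < 1"
  obtains q :: nat where "q \<ge> 2"
    "\<forall>\<^sub>F k in sequentially. \<exists>h\<le>k. real (q * k) ^ h * (1 - (1 - 1 / (real q - 1)) ^ h) ^ (k - 1) < 1
       \<and> (1 - \<epsilon>) * ln (real k) * (real (q * k) + 1) \<le> (real h + 1) * (real k - 1)"
proof -
  \<comment> \<open>Large enough for the slack between \<open>\<epsilon> / 2\<close> and
    \<open>\<epsilon> / 4\<close> to absorb replacing \<open>q\<close> by \<open>q - 2\<close> in
    \<open>aq\<close>.\<close>
  obtain q :: nat where q: "8 / \<epsilon> < real q" using reals_Archimedean2 by blast
  have "8 < 8 / \<epsilon>" using assms by (simp add: field_simps)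
  then have q8: "8 < real q" using q by linarith
  define a where "a = (1 - \<epsilon> / 2) * real q"
  have a: "a > 0" using assms q8 by (simp add: a_def)
  have aq: "a \<le> (1 - \<epsilon> / 4) * (real q - 2)"
    using q assms by (simp add: a_def field_simps)
  have ev: "\<forall>\<^sub>F k in sequentially. a * ln (real k) \<le> real k"
    using a by real_asymp
  have ev1: "\<forall>\<^sub>F k in sequentially. a * ln (real k) * ln (real q * real k) <
      exp (- (1 - \<epsilon> / 4) * ln (real k)) * (real k - 1)"
    using a assms q8 by real_asymp
  have ev2: "\<forall>\<^sub>F k in sequentially.
      (1 - \<epsilon>) * ln (real k) * (real q * real k + 1) \<le> a * ln (real k) * (real k - 1)"
  proof -
    have "(1 - \<epsilon>) * real q < a" using assms q8 by (simp add: a_def)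
    then show ?thesis using a assms q8 by real_asymp
  qed
  have "\<forall>\<^sub>F k in sequentially. \<exists>h\<le>k. real (q * k) ^ h * (1 - (1 - 1 / (real q - 1)) ^ h) ^ (k - 1) < 1
       \<and> (1 - \<epsilon>) * ln (real k) * (real (q * k) + 1) \<le> (real h + 1) * (real k - 1)"
    using ev ev1 ev2 eventually_ge_at_top[of 2]
  proof eventually_elim
    case (elim k)
    define h where "h = nat \<lfloor>a * ln (real k)\<rfloor>"
    define \<rho> where "\<rho> = (1 - 1 / (real q - 1)) ^ h"
    have nn: "0 \<le> a * ln (real k)" using a elim(4) by simp
    then have h: "real h \<le> a * ln (real k)" "a * ln (real k) \<le> real h + 1"
      unfolding h_def by linarith+
    have "h \<le> k" using h(1) elim(1) by linarith
    moreover have "(1 - \<epsilon>) * ln (real k) * (real (q * k) + 1) \<le> (real h + 1) * (real k - 1)"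
    proof -
      have "a * ln (real k) * (real k - 1) \<le> (real h + 1) * (real k - 1)"
        using h(2) elim(4) by (intro mult_right_mono) auto
      with elim(3) show ?thesis by simp
    qed
    moreover have "real (q * k) ^ h * (1 - \<rho>) ^ (k - 1) < 1"
    proof -
      \<comment> \<open>Inverting \<open>1 + x \<le> exp x\<close> at
        \<open>x = 1 / (q - 2)\<close>, since \<open>1 + x = (q - 1) / (q - 2)\<close>.\<close>
      have base: "exp (- (1 / (real q - 2))) \<le> 1 - 1 / (real q - 1)"
      proof -
        have "1 + 1 / (real q - 2) \<le> exp (1 / (real q - 2))" by (rule exp_ge_add_one_self)
        then have "inverse (exp (1 / (real q - 2))) \<le> inverse (1 + 1 / (real q - 2))"
          using q8 by (intro le_imp_inverse_le) (auto intro: add_pos_pos)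
        also have "\<dots> = 1 - 1 / (real q - 1)" using q8 by (simp add: field_simps)
        finally show ?thesis by (simp add: exp_minus)
      qed
      have "0 \<le> ln (real k)" using elim(4) by simp
      from mult_right_mono[OF aq this]
      have "real h \<le> (1 - \<epsilon> / 4) * (real q - 2) * ln (real k)"
        using h(1) by linarith
      then have "real h / (real q - 2) \<le> (1 - \<epsilon> / 4) * ln (real k)"
        using q8 by (simp add: field_simps)
      then have "exp (- (1 - \<epsilon> / 4) * ln (real k)) \<le> exp (- (real h / (real q - 2)))"
        by (simp only: exp_le_cancel_iff mult_minus_left neg_le_iff_le)
      also have "\<dots> = exp (- (1 / (real q - 2))) ^ h"
        by (simp add: exp_of_nat_mult[symmetric])
      also have "\<dots> \<le> \<rho>" unfolding \<rho>_def using base by (intro power_mono) auto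
      finally have \<rho>: "exp (- (1 - \<epsilon> / 4) * ln (real k)) \<le> \<rho>" .
      have "\<rho> \<le> 1" using q8 by (auto simp: \<rho>_def intro!: power_le_one)
      have qk: "1 \<le> real q * real k" using q8 elim(4) mult_mono[of 1 "real q" 1 "real k"] by simp
      have "real h * ln (real q * real k) \<le> a * ln (real k) * ln (real q * real k)"
        using h(1) qk by (intro mult_right_mono) auto
      also have "\<dots> < exp (- (1 - \<epsilon> / 4) * ln (real k)) * (real k - 1)" by (rule elim(2))
      also have "\<dots> \<le> \<rho> * (real k - 1)" using \<rho> elim(4) by (intro mult_right_mono) auto
      finally have key: "real h * ln (real q * real k) < \<rho> * (real k - 1)" .
      have "real (q * k) ^ h = exp (real h * ln (real q * real k))"
        using qk by (simp add: exp_of_nat_mult)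
      moreover have "(1 - \<rho>) ^ (k - 1) \<le> exp (- \<rho>) ^ (k - 1)"
        using \<open>\<rho> \<le> 1\<close> exp_ge_add_one_self[of "- \<rho>"] by (intro power_mono) auto
      moreover have "exp (- \<rho>) ^ (k - 1) = exp (- (\<rho> * (real k - 1)))"
        using elim(4) by (simp add: exp_of_nat_mult[symmetric] of_nat_diff mult_ac)
      ultimately have "real (q * k) ^ h * (1 - \<rho>) ^ (k - 1) \<le>
          exp (real h * ln (real q * real k)) * exp (- (\<rho> * (real k - 1)))"
        by (simp add: mult_left_mono)
      also have "\<dots> = exp (real h * ln (real q * real k) - \<rho> * (real k - 1))"
        by (simp add: exp_diff exp_minus divide_inverse)
      also have "\<dots> < 1" using key by simp
      finally show ?thesis .
    qed
    ultimately show ?case unfolding \<rho>_def by blast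
  qed
  moreover have "q \<ge> 2" using q8 by linarith
  ultimately show ?thesis using that by blast
qed

lemma explainable_lower_bound:
  fixes \<epsilon> :: real
  assumes "0 < \<epsilon>" "\<epsilon> < 1"
  shows "\<forall>\<^sub>F k in sequentially. \<exists>d X. finite X \<and> (\<forall>x\<in>X. in_Rd d x) \<and> opt_cost d k X > 0 \<and>
           (\<forall>t. valid_tree d t \<and> num_leaves t = k \<longrightarrow>
                tree_cost d t X \<ge> (1 - \<epsilon>) * ln (real k) * opt_cost d k X)"
proof -
  obtain q :: nat where q: "q \<ge> 2"
    "\<forall>\<^sub>F k in sequentially. \<exists>h\<le>k. real (q * k) ^ h * (1 - (1 - 1 / (real q - 1)) ^ h) ^ (k - 1) < 1
       \<and> (1 - \<epsilon>) * ln (real k) * (real (q * k) + 1) \<le> (real h + 1) * (real k - 1)"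
    using parameters_exist[OF assms] by blast
  show ?thesis using q(2) eventually_ge_at_top[of 2]
  proof eventually_elim
    case (elim k)
    then obtain h where h: "h \<le> k"
      "real (q * k) ^ h * (1 - (1 - 1 / (real q - 1)) ^ h) ^ (k - 1) < 1"
      "(1 - \<epsilon>) * ln (real k) * (real (q * k) + 1) \<le> (real h + 1) * (real k - 1)" by blast
    have "k > 1" using elim(2) by simp
    obtain F where F: "F \<subseteq> {S. S \<subseteq> {..<q * k} \<and> card S = k}" "card F = k - 1"
      "\<And>H. H \<subseteq> {..<q * k} \<Longrightarrow> \<forall>S\<in>F. H \<inter> S \<noteq> {} \<Longrightarrow> h < card H"
      using family_without_small_hitting_set[OF q(1) h(1) \<open>k > 1\<close> h(2)] by blast
    \<comment> \<open>Large enough that the minimum in \<open>tree_cost_ge\<close> is its second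
      argument.\<close>
    define L where "L = max (q * k) (max 2 (nat \<lceil>(real h + 1) * (real k - 1)\<rceil>))"
    interpret set_family_instance "q * k" k k h L F
      using F elim(2) by unfold_locales (auto simp: L_def)
    have L: "(real h + 1) * (real k - 1) \<le> real L" unfolding L_def by linarith
    have "(1 - \<epsilon>) * ln (real k) * opt_cost (Suc (q * k)) k X \<le> tree_cost (Suc (q * k)) t X"
      if "valid_tree (Suc (q * k)) t" "num_leaves t = k" for t
    proof -
      have "(1 - \<epsilon>) * ln (real k) * opt_cost (Suc (q * k)) k X
          \<le> (1 - \<epsilon>) * ln (real k) * (real (q * k) + 1)"
        using opt_le assms elim(2) by (intro mult_left_mono) auto
      with h(3) L tree_cost_ge[OF that] show ?thesis by linarith
    qed
    then show ?case using finite_X in_Rd_X opt_pos by blast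
  qed
qed

theorem theorem1p2:
  shows "\<forall>\<epsilon>::real. \<epsilon> > 0 \<longrightarrow> (\<exists>k0::nat. \<forall>k\<ge>k0. \<exists>(d::nat) (X::point set).
           finite X \<and> (\<forall>x\<in>X. in_Rd d x) \<and> opt_cost d k X > 0 \<and>
           (\<forall>t. valid_tree d t \<and> num_leaves t = k \<longrightarrow>
                tree_cost d t X \<ge> (1 - \<epsilon>) * ln (real k) * opt_cost d k X))"
proof (intro allI impI)
  fix \<epsilon> :: real assume "\<epsilon> > 0"
  \<comment> \<open>Keeps \<delta> below 1 even for large \<epsilon>; the bound for the smaller
    \<delta> is the stronger one.\<close>
  define \<delta> where "\<delta> = min \<epsilon> (1 / 2)"
  have \<delta>: "0 < \<delta>" "\<delta> < 1" using \<open>\<epsilon> > 0\<close> by (auto simp: \<delta>_def)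
  have "\<forall>\<^sub>F k in sequentially. \<exists>d X. finite X \<and> (\<forall>x\<in>X. in_Rd d x) \<and> opt_cost d k X > 0 \<and>
           (\<forall>t. valid_tree d t \<and> num_leaves t = k \<longrightarrow>
                tree_cost d t X \<ge> (1 - \<epsilon>) * ln (real k) * opt_cost d k X)"
    using explainable_lower_bound[OF \<delta>] eventually_ge_at_top[of 1]
  proof eventually_elim
    case (elim k)
    then obtain d X where X: "finite X" "\<forall>x\<in>X. in_Rd d x" "opt_cost d k X > 0"
      "\<And>t. valid_tree d t \<and> num_leaves t = k \<Longrightarrow>
         tree_cost d t X \<ge> (1 - \<delta>) * ln (real k) * opt_cost d k X" by blast
    have "(1 - \<epsilon>) * ln (real k) * opt_cost d k X \<le> (1 - \<delta>) * ln (real k) * opt_cost d k X"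
      using X(3) elim(2) by (intro mult_right_mono) (auto simp: \<delta>_def)
    with X show ?case by (meson order_trans)
  qed
  then show "\<exists>k0::nat. \<forall>k\<ge>k0. \<exists>(d::nat) (X::point set).
           finite X \<and> (\<forall>x\<in>X. in_Rd d x) \<and> opt_cost d k X > 0 \<and>
           (\<forall>t. valid_tree d t \<and> num_leaves t = k \<longrightarrow>
                tree_cost d t X \<ge> (1 - \<epsilon>) * ln (real k) * opt_cost d k X)"
    by (simp add: eventually_sequentially)
qed

end
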